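(* There exist absolute constants $C_1,C_2,C_3>0$ such that the following holds. Fix $\epsilon\in(0,1)$. Suppose every path $p$ has $\mathsf{val}(p)\in(0,1]$ and runs the Linear MIMD Protocol with $\beta_p\in(0,1)$, $\beta_p\le C_1\epsilon$, $\alpha_p=\epsilon\,\beta_p\,\mathsf{val}(p)$, and starting rate $f_0(p)>0$, where the fixed-rate assignment $f_0$ respects capacities; resources discard packets only when congested; and $\epsilon$-fair loss holds on each path. Let $U_p$ be the maximum amount received on $p$ in any round. If for every path $p$ \[ |T_p|\;\ge\;C_2\max_q\frac{(1+d_q)\ln\big(U_q/f_0(q)\big)}{\epsilon^2\,\beta_q\,\mathsf{val}(q)}, \] then the total weighted throughput $\sum_p\sum_{t\in T'_p}\mathsf{val}(p)\,\mathsf{rcvd}(p,t)$ is at least $(1-C_3\epsilon)\,\mathsf{opt}$.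
   Context: A network consists of resources $r$ with capacities $\mathsf{cap}(r,t)\ge0$ at discrete times $t\in\{0,1,2,\dots\}$. Each connection is a path $p$ (fixed ordered sequence of resources; $r\sim p$ means $p$ uses $r$) with value $\mathsf{val}(p)$, active interval $T_p=\{s_p,\dots,e_p\}$, integer round-trip delay $d_p\ge0$, and for each $r\sim p$ an integer $0\le d_{p,r}\le d_p$ (time to reach the destination after passing $r$); a packet injected on $p$ at time $t$ enters $r$ at time $t+d_p-d_{p,r}$ and, if not discarded, is received at time $t+d_p$. Let $T'_p=\{s_p+d_p,\dots,e_p+d_p\}$. Packet counts are nonnegative reals. $\mathsf{sent}(p,t)$: amount injected on $p$ at time $t$ (zero outside $T_p$); $\mathsf{rcvd}(p,t)$: amount received on $p$ at time $t$; $\mathsf{lost}(p,t)=\mathsf{sent}(p,t-d_p)-\mathsf{rcvd}(p,t)$; $\mathsf{lsr}(p,t)=\mathsf{lost}(p,t)/\mathsf{sent}(p,t-d_p)$; $\mathsf{into}(r,t)$: total amount entering $r$ at time $t$; $\mathsf{lost}(r,t)$: amount discarded at $r$ at time $t$ (a ratio $\mathsf{lost}(r,t)/\mathsf{into}(r,t)$ with zero denominator is $0$). Every discarded packet belongs to some path, and the packets of $p$ not received are exactly those discarded at resources of $p$. Only congested resources discard: $\mathsf{lost}(r,t)>0$ only if $\mathsf{into}(r,t)>\mathsf{cap}(r,t)$. $\epsilon$-fair loss for path $p$: $\sum_{t\in T'_p}\mathsf{lsr}(p,t)\le(1+\epsilon)\sum_{t\in T'_p}\sum_{r\sim p}\mathsf{lost}(r,t-d_{p,r})/\mathsf{into}(r,t-d_{p,r})$.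 The Linear MIMD Protocol on $p$ with parameters $\alpha_p>0,\beta_p\in(0,1)$ and starting rate $f_0(p)>0$ sets $\mathsf{sent}(p,t)=f_0(p)$ for $t=s_p,\dots,s_p+d_p$ and $\mathsf{sent}(p,t)=\mathsf{sent}(p,t-1-d_p)[1+\alpha_p-\beta_p\,\mathsf{lsr}(p,t-1)]$ for $t=s_p+1+d_p,\dots,e_p$. A fixed-rate solution assigns $f(p)\ge0$ to each path, sent at every time in $T_p$; it respects capacities if for all $r,t$, $\sum_{p\sim r:\,t-d_p+d_{p,r}\in T_p}f(p)\le\mathsf{cap}(r,t)$. $\mathsf{opt}$ is the maximum of $\sum_p\mathsf{val}(p)f(p)|T_p|$ over such solutions.
   Formalization: The length condition uses max{1, ln(U_q/f_0(q))} in place of ln(U_q/f_0(q)); with the plain logarithm the claim is false, e.g. for one path with d_p=0, |T_p|=1, val 1, f_0=1 and a resource of capacity 100. *)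

theory Defs
  imports Complex_Main
begin

(* Resources 'r and path names 'p are abstract. "delay_after N p r" is d_{p,r}, the time
   from passing r on p until reaching the destination. *)
record ('r, 'p) network =
  capacity :: "'r \<Rightarrow> nat \<Rightarrow> real"
  paths :: "'p set"
  route :: "'p \<Rightarrow> 'r list"
  val :: "'p \<Rightarrow> real"
  start :: "'p \<Rightarrow> nat"
  stop :: "'p \<Rightarrow> nat"
  delay :: "'p \<Rightarrow> nat"
  delay_after :: "'p \<Rightarrow> 'r \<Rightarrow> nat"

(* A path visits each resource at most once, since it has a single delay d_{p,r} for each r.
   Routes are nonempty: a path using no resource would make the optimum infinite. *)
definition valid_network :: "('r, 'p) network \<Rightarrow> bool" where
  "valid_network N \<longleftrightarrow>
     (\<forall>r t. 0 \<le> capacity N r t) \<and>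
     finite (paths N) \<and>
     (\<forall>p\<in>paths N. route N p \<noteq> [] \<and> distinct (route N p) \<and> start N p \<le> stop N p \<and>
        (\<forall>r\<in>set (route N p). delay_after N p r \<le> delay N p))"

definition active :: "('r, 'p) network \<Rightarrow> 'p \<Rightarrow> nat set" where
  "active N p = {start N p..stop N p}"

definition receiving :: "('r, 'p) network \<Rightarrow> 'p \<Rightarrow> nat set" where
  "receiving N p = {start N p + delay N p..stop N p + delay N p}"

definition users :: "('r, 'p) network \<Rightarrow> 'r \<Rightarrow> 'p set" where
  "users N r = {p \<in> paths N. r \<in> set (route N p)}"

(* "discarded X p r t" is the amount of packets of p that r discards at time t. *)
record ('r, 'p) traffic =
  sent :: "'p \<Rightarrow> nat \<Rightarrow> real"
  discarded :: "'p \<Rightarrow> 'r \<Rightarrow> nat \<Rightarrow> real"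

(* What is left, on reaching r, of the packets injected on p at time u: they reach an earlier
   resource r' of the route at time u + d_p - d_{p,r'}. *)
definition surviving :: "('r, 'p) network \<Rightarrow> ('r, 'p) traffic \<Rightarrow> 'p \<Rightarrow> 'r \<Rightarrow> nat \<Rightarrow> real" where
  "surviving N X p r u = sent X p u -
     (\<Sum>r'\<in>set (takeWhile (\<lambda>x. x \<noteq> r) (route N p)).
        discarded X p r' (u + delay N p - delay_after N p r'))"

(* Packets that p brings into r at time t were injected at time t - (d_p - d_{p,r}); nothing
   is injected before time 0, which the guard on the truncated subtraction expresses. *)
definition entering :: "('r, 'p) network \<Rightarrow> ('r, 'p) traffic \<Rightarrow> 'p \<Rightarrow> 'r \<Rightarrow> nat \<Rightarrow> real" where
  "entering N X p r t =
     (if delay N p - delay_after N p r \<le> t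
      then surviving N X p r (t - (delay N p - delay_after N p r)) else 0)"

definition into :: "('r, 'p) network \<Rightarrow> ('r, 'p) traffic \<Rightarrow> 'r \<Rightarrow> nat \<Rightarrow> real" where
  "into N X r t = (\<Sum>p\<in>users N r. entering N X p r t)"

definition lost_at :: "('r, 'p) network \<Rightarrow> ('r, 'p) traffic \<Rightarrow> 'r \<Rightarrow> nat \<Rightarrow> real" where
  "lost_at N X r t = (\<Sum>p\<in>users N r. discarded X p r t)"

definition rcvd :: "('r, 'p) network \<Rightarrow> ('r, 'p) traffic \<Rightarrow> 'p \<Rightarrow> nat \<Rightarrow> real" where
  "rcvd N X p t =
     (if delay N p \<le> t
      then sent X p (t - delay N p) -
             (\<Sum>r\<in>set (route N p). discarded X p r (t - delay_after N p r))
      else 0)"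

(* lost and lsr are used only at times t \<ge> d_p. *)
definition lost :: "('r, 'p) network \<Rightarrow> ('r, 'p) traffic \<Rightarrow> 'p \<Rightarrow> nat \<Rightarrow> real" where
  "lost N X p t = sent X p (t - delay N p) - rcvd N X p t"

definition lsr :: "('r, 'p) network \<Rightarrow> ('r, 'p) traffic \<Rightarrow> 'p \<Rightarrow> nat \<Rightarrow> real" where
  "lsr N X p t = lost N X p t / sent X p (t - delay N p)"

definition valid_traffic :: "('r, 'p) network \<Rightarrow> ('r, 'p) traffic \<Rightarrow> bool" where
  "valid_traffic N X \<longleftrightarrow>
     (\<forall>p\<in>paths N. (\<forall>t. 0 \<le> sent X p t) \<and> (\<forall>t. t \<notin> active N p \<longrightarrow> sent X p t = 0) \<and>
        (\<forall>r\<in>set (route N p). \<forall>t.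
           0 \<le> discarded X p r t \<and> discarded X p r t \<le> entering N X p r t))"

definition discards_only_if_congested :: "('r, 'p) network \<Rightarrow> ('r, 'p) traffic \<Rightarrow> bool" where
  "discards_only_if_congested N X \<longleftrightarrow>
     (\<forall>r t. lost_at N X r t > 0 \<longrightarrow> into N X r t > capacity N r t)"

definition fair_loss :: "real \<Rightarrow> ('r, 'p) network \<Rightarrow> ('r, 'p) traffic \<Rightarrow> 'p \<Rightarrow> bool" where
  "fair_loss \<epsilon> N X p \<longleftrightarrow>
     (\<Sum>t\<in>receiving N p. lsr N X p t) \<le>
     (1 + \<epsilon>) * (\<Sum>t\<in>receiving N p. \<Sum>r\<in>set (route N p).
        lost_at N X r (t - delay_after N p r) / into N X r (t - delay_after N p r))"

definition linear_MIMD ::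
  "('r, 'p) network \<Rightarrow> ('r, 'p) traffic \<Rightarrow> 'p \<Rightarrow> real \<Rightarrow> real \<Rightarrow> real \<Rightarrow> bool" where
  "linear_MIMD N X p \<alpha> \<beta> f0 \<longleftrightarrow>
     (\<forall>t\<in>active N p. sent X p t =
        (if t \<le> start N p + delay N p then f0
         else sent X p (t - 1 - delay N p) * (1 + \<alpha> - \<beta> * lsr N X p (t - 1))))"

(* t - d_p + d_{p,r} \<in> T_p is written t + d_{p,r} \<in> T'_p, to avoid truncated subtraction. *)
definition respects_capacities :: "('r, 'p) network \<Rightarrow> ('p \<Rightarrow> real) \<Rightarrow> bool" where
  "respects_capacities N f \<longleftrightarrow>
     (\<forall>p\<in>paths N. 0 \<le> f p) \<and>
     (\<forall>r t. (\<Sum>p\<in>{p \<in> users N r. t + delay_after N p r \<in> receiving N p}. f p) \<le> capacity N r t)"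

(* In a valid network with nonnegative values this supremum is attained: the constraints bound
   f p for every p, because routes and active intervals are nonempty. *)
definition opt :: "('r, 'p) network \<Rightarrow> real" where
  "opt N = Sup {(\<Sum>p\<in>paths N. val N p * f p * real (card (active N p))) | f.
                  respects_capacities N f}"

definition throughput :: "('r, 'p) network \<Rightarrow> ('r, 'p) traffic \<Rightarrow> real" where
  "throughput N X = (\<Sum>p\<in>paths N. \<Sum>t\<in>receiving N p. val N p * rcvd N X p t)"

(* This is U_p. The condition on |T_p| contains ln (U_q / f_0(q)). It is taken with the usual
   convention of asymptotic bounds that a logarithm stands for max 1 ln. The convention matters
   only when U_q < e f_0(q), and there it is needed: with the plain ln, a single path with
   d = 0, T = {0}, f_0 = 1 through a resource of capacity 100 has ln (U / f_0) = 0, so the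
   condition holds, but it receives only a hundredth of the optimum, for every \<epsilon>. *)
definition max_rcvd :: "('r, 'p) network \<Rightarrow> ('r, 'p) traffic \<Rightarrow> 'p \<Rightarrow> real" where
  "max_rcvd N X p = Max (rcvd N X p ` receiving N p)"

end

theory Submission
  imports Defs
begin

text \<open>
  The fixed-rate problem is a linear program, and the loss ratios \<open>lost(r,t)/into(r,t)\<close>, divided
  by \<open>\<epsilon>\<close>, are an almost feasible solution of its dual. Feasibility: the logarithm of the
  sending rate changes by about \<open>\<alpha> - \<beta> lsr\<close> in every step of length \<open>1 + d\<close> and is bounded, so
  the sum of \<open>lsr\<close> over the life of \<open>p\<close> is nearly \<open>\<alpha> |T|/\<beta> = \<epsilon> val |T|\<close>, and fair loss passes
  this on to the resources. Cost: a resource has a positive price only when \<open>into > cap\<close>, so the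
  dual cost is at most \<open>1/\<epsilon>\<close> times the total loss. Since the rates themselves change by
  \<open>\<alpha> sent - \<beta> lost\<close>, that loss is in turn at most about \<open>\<epsilon>\<close> times the throughput; the initial
  rates contribute an error that is absorbed because \<open>f0\<close> is itself a feasible solution.
\<close>

section \<open>The scalar recursion behind the protocol\<close>

text \<open>Differences over distance \<open>m\<close> telescope along each residue class mod
  \<open>m\<close>, leaving one window of \<open>m\<close> terms at either end. It is applied to the
  rates and to their logarithms.\<close>

lemma sum_step_telescope:
  fixes g :: "nat \<Rightarrow> 'a::ab_group_add"
  shows "(\<Sum>j<k. g (j + m) - g j) = (\<Sum>j<m. g (k + j)) - (\<Sum>j<m. g j)"
proof (induction k)
  case (Suc k)
  have "(\<Sum>j<m. g (Suc k + j)) = (\<Sum>j<m. g (k + j)) + g (k + m) - g k"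
    using sum.lessThan_Suc[of "\<lambda>j. g (k + j)" m] sum.lessThan_Suc_shift[of "\<lambda>j. g (k + j)" m]
    by (simp add: algebra_simps)
  with Suc show ?case by (simp add: algebra_simps)
qed simp

text \<open>One path with its delays shifted away: \<open>x j\<close> is the amount sent in the
  \<open>j\<close>-th active round, \<open>l j\<close> the loss ratio of those same packets,
  \<open>m\<close> is one plus the round-trip delay, and \<open>n\<close> the number of active
  rounds.\<close>

locale mimd_sequence =
  fixes x l :: "nat \<Rightarrow> real" and a b c :: real and n m :: nat
  assumes init: "j < m \<Longrightarrow> x j = c"
    and step: "j + m < n \<Longrightarrow> x (j + m) = x j * (1 + a - b * l j)"
    and l_nonneg: "j < n \<Longrightarrow> 0 \<le> l j"
    and l_le_1: "j < n \<Longrightarrow> l j \<le> 1"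
    and c_pos: "0 < c" and a_nonneg: "0 \<le> a" and b_pos: "0 < b" and b_less_1: "b < 1"
    and m_pos: "0 < m" and m_le_n: "m \<le> n"
begin

lemma x_induct [consumes 1, case_names init step]:
  assumes "j < n" "P c"
    and "\<And>j. j + m < n \<Longrightarrow> P (x j) \<Longrightarrow> P (x j * (1 + a - b * l j))"
  shows "P (x j)"
  using assms(1)
proof (induction j rule: less_induct)
  case (less j)
  show ?case
  proof (cases "j < m")
    case True
    then show ?thesis using init assms(2) by simp
  next
    case False
    then have "j = (j - m) + m" by simp
    then show ?thesis
      using less.IH[of "j - m"] less.prems m_pos assms(3)[of "j - m"] step[of "j - m"] by simp
  qed
qed

lemma bl_le: "j < n \<Longrightarrow> b * l j \<le> b"
  using mult_left_mono[OF l_le_1, of j b] b_pos by simp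

lemma factor_pos: "j < n \<Longrightarrow> 0 < 1 + a - b * l j"
  using bl_le[of j] b_less_1 a_nonneg by linarith

lemma x_pos: "j < n \<Longrightarrow> 0 < x j"
proof (induction rule: x_induct)
  case (step j)
  then show ?case using factor_pos[of j] by simp
qed (use c_pos in simp)

text \<open>If \<open>a \<le> b/2\<close>, the received amount controls the sent amount, because
  \<open>x (j + m) = x j * (1 + a - b) + b * (x j * (1 - l j))\<close> is a contraction towards at most \<open>2 U\<close>.\<close>

lemma x_le_max:
  assumes "\<And>j. j < n \<Longrightarrow> x j * (1 - l j) \<le> U" "a \<le> b / 2" "j < n"
  shows "x j \<le> max c (2 * U)"
  using assms(3)
proof (induction rule: x_induct)
  case (step j)
  have "x j * (1 + a - b * l j) = x j * (1 + a - b) + b * (x j * (1 - l j))"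
    by (simp add: algebra_simps)
  also have "\<dots> \<le> x j * (1 - b / 2) + b * U"
    using assms(1)[of j] assms(2) step(1) x_pos[of j] b_pos
    by (intro add_mono mult_left_mono) auto
  \<comment> \<open>\<open>U\<close> is at most half of \<open>max c (2 * U)\<close>; this is what
    the factor 2 in the bound is for.\<close>
  also have "\<dots> \<le> max c (2 * U) * (1 - b / 2) + b * (max c (2 * U) / 2)"
    using step(2) b_pos b_less_1 by (intro add_mono mult_left_mono mult_right_mono) auto
  also have "\<dots> = max c (2 * U)" by (simp add: algebra_simps)
  finally show ?case .
qed simp

lemma sum_split: "(\<Sum>j<n. g j) = (\<Sum>j<n - m. g j) + (\<Sum>j<m. g (n - m + j) :: real)"
proof -
  have "(\<Sum>j<k + i. g j) = (\<Sum>j<k. g j) + (\<Sum>j<i. g (k + j))" for k i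
    by (induction i) simp_all
  from this[of "n - m" m] show ?thesis using m_le_n by simp
qed

text \<open>Each step changes the rate by \<open>a * x j - b * (x j * l j)\<close>. Summed up, total
  growth minus total cuts is the last window of rates minus the first, which is
  \<open>m * c\<close>.\<close>

lemma sum_lost_le: "b * (\<Sum>j<n. x j * l j) \<le> a * (\<Sum>j<n. x j) + m * c"
proof -
  let ?k = "n - m"
  have "a * (\<Sum>j<?k. x j) - b * (\<Sum>j<?k. x j * l j) = (\<Sum>j<?k. x (j + m) - x j)"
    using step unfolding sum_distrib_left sum_subtractf[symmetric]
    by (intro sum.cong) (auto simp: algebra_simps)
  also have "\<dots> = (\<Sum>j<m. x (?k + j)) - m * c"
    using init by (simp add: sum_step_telescope)
  finally have eq: "a * (\<Sum>j<?k. x j) - b * (\<Sum>j<?k. x j * l j) = (\<Sum>j<m. x (?k + j)) - m * c" .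
  \<comment> \<open>Losses of the last \<open>m\<close> rounds come too late to change any rate; the
    final rates left over by the telescoping pay for them.\<close>
  have "b * (\<Sum>j<m. x (?k + j) * l (?k + j)) \<le> (\<Sum>j<m. x (?k + j))"
    unfolding sum_distrib_left
  proof (intro sum_mono)
    fix j assume "j \<in> {..<m}"
    then have j: "?k + j < n" using m_le_n by simp
    have "x (?k + j) * (b * l (?k + j)) \<le> x (?k + j) * 1"
      using bl_le[OF j] b_less_1 x_pos[OF j] by (intro mult_left_mono) auto
    then show "b * (x (?k + j) * l (?k + j)) \<le> x (?k + j)" by (simp add: algebra_simps)
  qed
  moreover have "0 \<le> a * (\<Sum>j<m. x (?k + j))"
    using a_nonneg m_le_n by (intro mult_nonneg_nonneg sum_nonneg less_imp_le[OF x_pos]) auto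
  ultimately show ?thesis
    using eq by (simp add: sum_split[of x] sum_split[of "\<lambda>j. x j * l j"] distrib_left)
qed

text \<open>The logarithm of the rate grows by \<open>ln (1 + y)\<close> with
  \<open>y = a - b * l j\<close>, yet it can never exceed \<open>ln M\<close>, so the losses must
  offset almost all of the growth. The corrections \<open>2 * a\<close> and \<open>2 * b\<close>
  come from the quadratic error of the logarithm.\<close>

lemma sum_loss_rate_ge:
  assumes "a \<le> 1/2" "b \<le> 1/2" and M: "\<And>j. j < n \<Longrightarrow> x j \<le> M"
  shows "a * (1 - 2 * a) * (real n - real m) - m * ln (M / c) \<le> b * (1 + 2 * b) * (\<Sum>j<n. l j)"
proof -
  let ?k = "n - m"
  have *: "a * (1 - 2 * a) - b * (1 + 2 * b) * l j \<le> ln (x (j + m)) - ln (x j)" if "j < ?k" for j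
  proof -
    have j: "j < n" "j + m < n" using that by auto
    define y where "y = a - b * l j"
    have bl: "0 \<le> b * l j" using l_nonneg[OF j(1)] b_pos by simp
    have "\<bar>y\<bar> \<le> 1/2"
      using bl bl_le[OF j(1)] a_nonneg assms(1,2) unfolding y_def by linarith
    then have "y - 2 * y\<^sup>2 \<le> ln (1 + y)"
      using abs_ln_one_plus_x_minus_x_bound[of y] by (simp add: abs_le_iff)
    \<comment> \<open>The mixed term of the square is nonpositive, and \<open>l j\<close> in [0,1]
      makes its square at most \<open>l j\<close>; the error thus stays linear in the loss
      ratio.\<close>
    moreover have "y\<^sup>2 \<le> a\<^sup>2 + b\<^sup>2 * l j"
    proof -
      have "y\<^sup>2 \<le> a\<^sup>2 + (b * l j)\<^sup>2"
        using mult_nonneg_nonneg[OF a_nonneg bl]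
        unfolding y_def by (simp add: power2_eq_square algebra_simps)
      moreover have "(l j)\<^sup>2 \<le> l j"
        using mult_left_mono[OF l_le_1 l_nonneg, OF j(1) j(1)] by (simp add: power2_eq_square)
      then have "(b * l j)\<^sup>2 \<le> b\<^sup>2 * l j"
        by (simp add: power_mult_distrib mult_left_mono)
      ultimately show ?thesis by linarith
    qed
    moreover have "ln (x (j + m)) - ln (x j) = ln (1 + y)"
      using x_pos[OF j(1)] factor_pos[OF j(1)] ln_mult_pos[of "x j" "1 + a - b * l j"]
      unfolding step[OF j(2)] y_def by (simp add: add_diff_eq)
    ultimately show ?thesis
      unfolding y_def by (simp add: algebra_simps power2_eq_square)
  qed
  have "a * (1 - 2 * a) * (real n - real m) - b * (1 + 2 * b) * (\<Sum>j<?k. l j)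
      = (\<Sum>j<?k. a * (1 - 2 * a) - b * (1 + 2 * b) * l j)"
    using m_le_n by (simp add: sum_subtractf sum_distrib_left[symmetric] of_nat_diff)
  also have "\<dots> \<le> (\<Sum>j<?k. ln (x (j + m)) - ln (x j))"
    using * by (intro sum_mono) auto
  also have "\<dots> = (\<Sum>j<m. ln (x (?k + j))) - m * ln c"
    using init by (simp add: sum_step_telescope[where g = "\<lambda>j. ln (x j)"])
  also have "\<dots> \<le> (\<Sum>j<m. ln M) - m * ln c"
    using M x_pos m_le_n by (intro diff_right_mono sum_mono ln_mono) auto
  also have "\<dots> = m * ln (M / c)"
    using c_pos x_pos[of 0] M[of 0] m_pos m_le_n by (simp add: ln_div algebra_simps)
  finally have "a * (1 - 2 * a) * (real n - real m) - m * ln (M / c) \<le> b * (1 + 2 * b) * (\<Sum>j<?k. l j)"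
    by simp
  also have "\<dots> \<le> b * (1 + 2 * b) * (\<Sum>j<n. l j)"
    using b_pos l_nonneg by (intro mult_left_mono sum_mono2) auto
  finally show ?thesis .
qed

end

section \<open>Bookkeeping of packets in the network\<close>

context
  fixes N :: "('r, 'p) network" and X :: "('r, 'p) traffic"
  assumes network: "valid_network N" and traffic: "valid_traffic N X"
begin

lemma finite_paths: "finite (paths N)"
  using network unfolding valid_network_def by simp

lemma finite_users: "finite (users N r)"
  using finite_paths unfolding users_def by simp

lemma delay_after_le: "p \<in> paths N \<Longrightarrow> r \<in> set (route N p) \<Longrightarrow> delay_after N p r \<le> delay N p"
  using network unfolding valid_network_def by blast

lemma discarded_nonneg: "p \<in> paths N \<Longrightarrow> r \<in> set (route N p) \<Longrightarrow> 0 \<le> discarded X p r t"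
  using traffic unfolding valid_traffic_def by blast

lemma discarded_le: "p \<in> paths N \<Longrightarrow> r \<in> set (route N p) \<Longrightarrow> discarded X p r t \<le> entering N X p r t"
  using traffic unfolding valid_traffic_def by blast

lemma entering_nonneg: "p \<in> paths N \<Longrightarrow> r \<in> set (route N p) \<Longrightarrow> 0 \<le> entering N X p r t"
  using discarded_nonneg discarded_le order_trans by meson

lemma lost_at_nonneg: "0 \<le> lost_at N X r t"
  unfolding lost_at_def users_def by (intro sum_nonneg discarded_nonneg) auto

lemma into_nonneg: "0 \<le> into N X r t"
  unfolding into_def users_def by (intro sum_nonneg entering_nonneg) auto

lemma sent_nonneg: "p \<in> paths N \<Longrightarrow> 0 \<le> sent X p t"
  using traffic unfolding valid_traffic_def by blast

lemma surviving_le_sent: "p \<in> paths N \<Longrightarrow> surviving N X p r u \<le> sent X p u"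
  unfolding surviving_def
  by (auto intro!: sum_nonneg discarded_nonneg dest: set_takeWhileD)

text \<open>The packets of \<open>p\<close> that could be at \<open>r\<close> at time
  \<open>t\<close> would have been injected outside the active interval, where nothing is
  sent.\<close>

lemma discarded_eq_0:
  assumes p: "p \<in> paths N" "r \<in> set (route N p)" and t: "t + delay_after N p r \<notin> receiving N p"
  shows "discarded X p r t = 0"
proof -
  let ?u = "t - (delay N p - delay_after N p r)"
  have "entering N X p r t \<le> 0"
  proof (cases "delay N p - delay_after N p r \<le> t")
    case True
    then have "?u \<notin> active N p"
      using t delay_after_le[OF p] unfolding receiving_def active_def by auto
    then have "sent X p ?u = 0"
      using traffic p unfolding valid_traffic_def by blast
    then show ?thesis
      using surviving_le_sent[OF p(1), of r ?u] True unfolding entering_def by simp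
  qed (simp add: entering_def)
  then show ?thesis
    using discarded_nonneg[OF p] discarded_le[OF p] by (meson order_antisym order_trans)
qed

lemma lost_eq:
  assumes "delay N p \<le> t"
  shows "lost N X p t = (\<Sum>r\<in>set (route N p). discarded X p r (t - delay_after N p r))"
  using assms unfolding lost_def rcvd_def by simp

lemma lost_nonneg: "p \<in> paths N \<Longrightarrow> delay N p \<le> t \<Longrightarrow> 0 \<le> lost N X p t"
  by (simp add: lost_eq sum_nonneg discarded_nonneg)

text \<open>Validity of the traffic bounds each single discard; at the last resource of the route that
  bound is the one on the sum of all discards.\<close>

lemma rcvd_nonneg:
  assumes p: "p \<in> paths N"
  shows "0 \<le> rcvd N X p t"
proof (cases "delay N p \<le> t")
  case True
  let ?z = "last (route N p)" and ?g = "\<lambda>r. discarded X p r (t - delay_after N p r)"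
  have ne: "route N p \<noteq> []" and dist: "distinct (route N p)"
    using network p unfolding valid_network_def by auto
  obtain rs where rs: "route N p = rs @ [?z]"
    using ne by (metis append_butlast_last_id)
  have z: "?z \<notin> set rs" "?z \<in> set (route N p)"
    using dist ne rs by (metis distinct_append disjoint_iff list.set_intros(1), simp)
  \<comment> \<open>As \<open>?z\<close> occurs only at the end, what enters it is already reduced
    by the discards at all other resources of the route.\<close>
  have "takeWhile (\<lambda>r. r \<noteq> ?z) (rs @ [?z]) = rs"
    using z(1) by (subst takeWhile_append2) auto
  then have tw: "takeWhile (\<lambda>r. r \<noteq> ?z) (route N p) = rs"
    using rs by simp
  have "delay N p - delay_after N p ?z \<le> t - delay_after N p ?z"
    and "t - delay_after N p ?z - (delay N p - delay_after N p ?z) = t - delay N p"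
    using True delay_after_le[OF p z(2)] by auto
  then have "?g ?z \<le> sent X p (t - delay N p) - (\<Sum>r\<in>set rs. ?g r)"
    using discarded_le[OF p z(2), of "t - delay_after N p ?z"] True
    by (simp add: entering_def surviving_def tw)
  moreover have "(\<Sum>r\<in>set (route N p). ?g r) = (\<Sum>r\<in>set rs. ?g r) + ?g ?z"
    using z(1) by (subst rs) simp
  ultimately show ?thesis
    using True unfolding rcvd_def by simp
qed (simp add: rcvd_def)

section \<open>Linear programming duality\<close>

text \<open>A packet received at \<open>t\<close> passed \<open>r\<close> at
  \<open>t - delay_after N p r\<close>, so a sum over paths and receiving times can be regrouped by
  resource and passing time. \<open>H\<close> is a horizon that makes the time range finite.\<close>

lemma sum_paths_receiving_swap:
  fixes g :: "'p \<Rightarrow> 'r \<Rightarrow> nat \<Rightarrow> real"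
  assumes H: "\<And>p. p \<in> paths N \<Longrightarrow> stop N p + delay N p \<le> H"
  shows "(\<Sum>p\<in>paths N. \<Sum>t\<in>receiving N p. \<Sum>r\<in>set (route N p). g p r (t - delay_after N p r))
       = (\<Sum>r\<in>(\<Union>p\<in>paths N. set (route N p)). \<Sum>\<tau>\<le>H.
            \<Sum>p\<in>{p \<in> users N r. \<tau> + delay_after N p r \<in> receiving N p}. g p r \<tau>)"
    (is "_ = (\<Sum>r\<in>?R. _)")
proof -
  let ?g = "\<lambda>p r \<tau>. if \<tau> + delay_after N p r \<in> receiving N p then g p r \<tau> else 0"
  have finR: "finite ?R" using finite_paths by simp
  have shift: "(\<Sum>t\<in>receiving N p. g p r (t - delay_after N p r)) = (\<Sum>\<tau>\<le>H. ?g p r \<tau>)"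
    if p: "p \<in> paths N" "r \<in> set (route N p)" for p r
  proof -
    \<comment> \<open>Receiving times are at least \<open>delay N p\<close>, so the subtraction does
      not truncate and the shift is a bijection.\<close>
    have "(\<Sum>t\<in>receiving N p. g p r (t - delay_after N p r))
        = (\<Sum>\<tau>\<in>{\<tau>\<in>{..H}. \<tau> + delay_after N p r \<in> receiving N p}. g p r \<tau>)"
      using H[OF p(1)] delay_after_le[OF p]
      by (intro sum.reindex_bij_witness[where i = "\<lambda>\<tau>. \<tau> + delay_after N p r"
            and j = "\<lambda>t. t - delay_after N p r"]) (auto simp: receiving_def)
    then show ?thesis by (subst (asm) sum.inter_filter) simp_all
  qed
  have "(\<Sum>p\<in>paths N. \<Sum>t\<in>receiving N p. \<Sum>r\<in>set (route N p). g p r (t - delay_after N p r))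
      = (\<Sum>p\<in>paths N. \<Sum>r\<in>set (route N p). \<Sum>\<tau>\<le>H. ?g p r \<tau>)"
    by (subst sum.swap) (simp add: shift)
  also have "\<dots> = (\<Sum>p\<in>paths N. \<Sum>r\<in>{r\<in>?R. r \<in> set (route N p)}. \<Sum>\<tau>\<le>H. ?g p r \<tau>)"
    by (intro sum.cong) auto
  also have "\<dots> = (\<Sum>r\<in>?R. \<Sum>p\<in>users N r. \<Sum>\<tau>\<le>H. ?g p r \<tau>)"
    unfolding users_def by (rule sum.swap_restrict[OF finite_paths finR])
  also have "\<dots> = (\<Sum>r\<in>?R. \<Sum>\<tau>\<le>H. \<Sum>p\<in>users N r. ?g p r \<tau>)"
    by (intro sum.cong refl sum.swap)
  finally show ?thesis by (simp add: sum.inter_filter finite_users)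
qed

text \<open>\<open>Sup\<close> on the reals is meaningless without an upper bound; here each rate is at most the capacity
  of the first resource of its path.\<close>

lemma value_le_opt:
  assumes f: "respects_capacities N f" and v: "\<forall>p\<in>paths N. 0 \<le> val N p"
  shows "(\<Sum>p\<in>paths N. val N p * f p * real (card (active N p))) \<le> opt N"
  unfolding opt_def
proof (rule cSup_upper)
  let ?r = "\<lambda>p. hd (route N p)"
  \<comment> \<open>This is the capacity at the moment when packets injected at
    \<open>start N p\<close> enter the first resource, so \<open>f p\<close> occurs in that
    constraint.\<close>
  let ?cap = "\<lambda>p. capacity N (?r p) (start N p + delay N p - delay_after N p (?r p))"
  have f_le: "f p \<le> ?cap p" if f: "respects_capacities N f" and p: "p \<in> paths N" for f p
  proof -
    let ?t = "start N p + delay N p - delay_after N p (?r p)"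
    have r: "?r p \<in> set (route N p)" and "start N p \<le> stop N p"
      using network p unfolding valid_network_def by auto
    then have "p \<in> {q \<in> users N (?r p). ?t + delay_after N q (?r p) \<in> receiving N q}"
      using p delay_after_le[OF p r] unfolding users_def receiving_def by auto
    then have "f p \<le> (\<Sum>q\<in>{q \<in> users N (?r p). ?t + delay_after N q (?r p) \<in> receiving N q}. f q)"
      using f unfolding respects_capacities_def
      by (intro member_le_sum) (auto simp: finite_users, auto simp: users_def)
    then show ?thesis
      using f unfolding respects_capacities_def by (meson order_trans)
  qed
  show "bdd_above {\<Sum>p\<in>paths N. val N p * f p * real (card (active N p)) |f. respects_capacities N f}"
    using f_le v
    by (intro bdd_aboveI[of _ "\<Sum>p\<in>paths N. val N p * ?cap p * real (card (active N p))"])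
       (auto intro!: sum_mono mult_right_mono mult_left_mono)
qed (use f in blast)

text \<open>With \<open>lost_at / into\<close> as unscaled dual price of a resource at a time, this
  is the left side of the dual constraint of \<open>p\<close>. It is also the sum on the right of
  \<open>fair_loss\<close>.\<close>

definition congestion_price :: "'p \<Rightarrow> real" where
  "congestion_price p = (\<Sum>t\<in>receiving N p. \<Sum>r\<in>set (route N p).
     lost_at N X r (t - delay_after N p r) / into N X r (t - delay_after N p r))"

lemma congestion_price_nonneg: "0 \<le> congestion_price p"
  unfolding congestion_price_def
  by (intro sum_nonneg divide_nonneg_nonneg lost_at_nonneg into_nonneg)

text \<open>Where the price \<open>lost_at / into\<close> is positive, a feasible load is at most
  the capacity and hence below \<open>into\<close>, so load times price is at most
  \<open>lost_at\<close>. Regrouped by paths, these amounts are the path losses.\<close>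

lemma weak_duality:
  assumes congested: "discards_only_if_congested N X" and f: "respects_capacities N f"
  shows "(\<Sum>p\<in>paths N. f p * congestion_price p)
       \<le> (\<Sum>p\<in>paths N. \<Sum>t\<in>receiving N p. lost N X p t)"
proof -
  define H where "H = (\<Sum>p\<in>paths N. stop N p + delay N p)"
  have H: "stop N p + delay N p \<le> H" if "p \<in> paths N" for p
    unfolding H_def by (rule member_le_sum[OF that _ finite_paths]) simp
  let ?R = "\<Union>p\<in>paths N. set (route N p)"
  let ?P = "\<lambda>r \<tau>. {p \<in> users N r. \<tau> + delay_after N p r \<in> receiving N p}"
  let ?y = "\<lambda>r \<tau>. lost_at N X r \<tau> / into N X r \<tau>"
  have y: "(\<Sum>p\<in>?P r \<tau>. f p) * ?y r \<tau> \<le> lost_at N X r \<tau>" for r \<tau>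
  proof (cases "lost_at N X r \<tau> > 0")
    case True
    then have "capacity N r \<tau> < into N X r \<tau>"
      using congested unfolding discards_only_if_congested_def by blast
    moreover have "(\<Sum>p\<in>?P r \<tau>. f p) \<le> capacity N r \<tau>" "0 \<le> capacity N r \<tau>"
      using f network unfolding respects_capacities_def valid_network_def by auto
    ultimately show ?thesis
      using True by (simp add: field_simps mult_left_mono)
  next
    case False
    then show ?thesis using lost_at_nonneg[of r \<tau>] by simp
  qed
  have "(\<Sum>p\<in>paths N. f p * congestion_price p)
      = (\<Sum>p\<in>paths N. \<Sum>t\<in>receiving N p. \<Sum>r\<in>set (route N p).
           f p * ?y r (t - delay_after N p r))"
    unfolding congestion_price_def by (simp add: sum_distrib_left)
  also have "\<dots> = (\<Sum>r\<in>?R. \<Sum>\<tau>\<le>H. (\<Sum>p\<in>?P r \<tau>. f p) * ?y r \<tau>)"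
    unfolding sum_distrib_right
    by (rule sum_paths_receiving_swap[where g = "\<lambda>p r \<tau>. f p * ?y r \<tau>", OF H])
  also have "\<dots> \<le> (\<Sum>r\<in>?R. \<Sum>\<tau>\<le>H. lost_at N X r \<tau>)"
    by (intro sum_mono y)
  \<comment> \<open>The users left out of \<open>?P r \<tau>\<close> have no packets at
    \<open>r\<close> to discard at that time.\<close>
  also have "\<dots> = (\<Sum>r\<in>?R. \<Sum>\<tau>\<le>H. \<Sum>p\<in>?P r \<tau>. discarded X p r \<tau>)"
    unfolding lost_at_def
    by (intro sum.cong refl sum.mono_neutral_right finite_users)
       (auto simp: users_def discarded_eq_0)
  also have "\<dots> = (\<Sum>p\<in>paths N. \<Sum>t\<in>receiving N p. \<Sum>r\<in>set (route N p).
      discarded X p r (t - delay_after N p r))"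
    by (rule sum_paths_receiving_swap[OF H, symmetric])
  also have "\<dots> = (\<Sum>p\<in>paths N. \<Sum>t\<in>receiving N p. lost N X p t)"
    by (intro sum.cong refl) (auto simp: lost_eq receiving_def)
  finally show ?thesis .
qed

section \<open>A single path running the protocol\<close>

context
  fixes p :: 'p and \<alpha> \<beta> f0 :: real
  assumes p: "p \<in> paths N" and protocol: "linear_MIMD N X p \<alpha> \<beta> f0"
    and \<alpha>: "0 \<le> \<alpha>" and \<beta>: "0 < \<beta>" "\<beta> < 1" and f0: "0 < f0"
    and long: "1 + delay N p \<le> card (active N p)"
begin

lemma card_active: "card (active N p) = Suc (stop N p) - start N p"
  unfolding active_def by simp

lemma sum_receiving:
  "(\<Sum>t\<in>receiving N p. g t) = (\<Sum>j<card (active N p). g (start N p + delay N p + j) :: real)"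
  unfolding card_active receiving_def
  by (rule sum.reindex_bij_witness[where i = "\<lambda>j. start N p + delay N p + j"
        and j = "\<lambda>t. t - (start N p + delay N p)"]) auto

text \<open>The packets sent in round \<open>j\<close> are accounted for at
  \<open>start N p + delay N p + j\<close>, one tick before the rate that reacts to them; hence the
  window length \<open>1 + delay N p\<close>. The bound 1 on the loss ratio is
  \<open>rcvd_nonneg\<close>.\<close>

lemma mimd_sequence:
  "mimd_sequence (\<lambda>j. sent X p (start N p + j)) (\<lambda>j. lsr N X p (start N p + delay N p + j))
     \<alpha> \<beta> f0 (card (active N p)) (1 + delay N p)"
proof
  fix j
  show "sent X p (start N p + j) = f0" if "j < 1 + delay N p"
    using that protocol long card_active unfolding linear_MIMD_def active_def by auto
  show "sent X p (start N p + (j + (1 + delay N p))) = sent X p (start N p + j) *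
      (1 + \<alpha> - \<beta> * lsr N X p (start N p + delay N p + j))"
    if "j + (1 + delay N p) < card (active N p)"
  proof -
    have "start N p + (j + (1 + delay N p)) \<in> active N p"
      using that card_active unfolding active_def by auto
    moreover have "start N p + (j + (1 + delay N p)) - 1 - delay N p = start N p + j"
      and "start N p + (j + (1 + delay N p)) - 1 = start N p + delay N p + j" by simp_all
    ultimately show ?thesis
      using protocol unfolding linear_MIMD_def by (simp only: if_False) simp
  qed
  have s: "0 \<le> sent X p (start N p + j)" by (rule sent_nonneg[OF p])
  show "0 \<le> lsr N X p (start N p + delay N p + j)"
    unfolding lsr_def by (intro divide_nonneg_nonneg lost_nonneg sent_nonneg p) simp
  have "lost N X p (start N p + delay N p + j) \<le> sent X p (start N p + j)"
    using rcvd_nonneg[OF p, of "start N p + delay N p + j"] unfolding lost_def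
    by (simp add: algebra_simps)
  then show "lsr N X p (start N p + delay N p + j) \<le> 1"
    using s unfolding lsr_def by (auto simp: divide_le_eq_1 add.commute add.left_commute)
qed (use \<alpha> \<beta> f0 long in auto)

interpretation S: mimd_sequence "\<lambda>j. sent X p (start N p + j)"
  "\<lambda>j. lsr N X p (start N p + delay N p + j)" \<alpha> \<beta> f0 "card (active N p)" "1 + delay N p"
  by (rule mimd_sequence)

lemma sent_times_lsr:
  assumes "j < card (active N p)"
  shows "sent X p (start N p + j) * lsr N X p (start N p + delay N p + j)
       = lost N X p (start N p + delay N p + j)"
  using S.x_pos[OF assms] unfolding lsr_def by (simp add: algebra_simps)

lemma total_lost_le:
  "\<beta> * (\<Sum>t\<in>receiving N p. lost N X p t)
     \<le> \<alpha> * (\<Sum>t\<in>receiving N p. rcvd N X p t + lost N X p t) + (1 + real (delay N p)) * f0"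
proof -
  have "sent X p (start N p + j)
      = rcvd N X p (start N p + delay N p + j) + lost N X p (start N p + delay N p + j)" for j
    unfolding lost_def by (simp add: algebra_simps)
  then show ?thesis
    using S.sum_lost_le sent_times_lsr unfolding sum_receiving by simp
qed

text \<open>The length condition speaks of the received amount, but the logarithmic estimate needs a
  bound on what is sent.\<close>

lemma sent_le_max_rcvd:
  assumes "\<alpha> \<le> \<beta> / 2" "j < card (active N p)"
  shows "sent X p (start N p + j) \<le> max f0 (2 * max_rcvd N X p)"
proof (rule S.x_le_max[OF _ assms])
  fix j assume j: "j < card (active N p)"
  have "sent X p (start N p + j) * (1 - lsr N X p (start N p + delay N p + j))
      = rcvd N X p (start N p + delay N p + j)"
    using sent_times_lsr[OF j] unfolding lost_def by (simp add: algebra_simps)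
  also have "\<dots> \<le> max_rcvd N X p"
    using j card_active unfolding max_rcvd_def receiving_def by (intro Max_ge) auto
  finally show "sent X p (start N p + j) * (1 - lsr N X p (start N p + delay N p + j))
      \<le> max_rcvd N X p" .
qed

text \<open>The factor 2 adds only \<open>ln 2\<close>, which is at most 1 and so is absorbed by
  \<open>max 1\<close>; if \<open>f0\<close> is the larger entry, the left side is 0.\<close>

lemma ln_max_sent_le:
  "ln (max f0 (2 * max_rcvd N X p) / f0) \<le> 2 * max 1 (ln (max_rcvd N X p / f0))"
proof (cases "2 * max_rcvd N X p \<le> f0")
  case True
  then show ?thesis using f0 by (simp add: max_def)
next
  case False
  have "ln (2::real) \<le> 1" using ln_le_minus_one[of "2::real"] by simp
  moreover have "ln (max f0 (2 * max_rcvd N X p) / f0) = ln 2 + ln (max_rcvd N X p / f0)"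
    using False f0 ln_mult_pos[of 2 "max_rcvd N X p / f0"] by (simp add: max_def)
  ultimately show ?thesis by linarith
qed

text \<open>Approximate dual feasibility. Since \<open>\<alpha> / \<beta> = \<epsilon> * v\<close>,
  the sum of the loss ratios is nearly \<open>\<epsilon> * v\<close> per active round, and fair loss
  charges it to the resources.\<close>

lemma congestion_price_ge:
  assumes \<epsilon>: "0 < \<epsilon>" "\<epsilon> \<le> 1/2" and v: "0 < v" "v \<le> 1"
    and \<alpha>_eq: "\<alpha> = \<epsilon> * \<beta> * v" and \<beta>_le: "\<beta> \<le> \<epsilon>" and fair: "fair_loss \<epsilon> N X p"
    and T: "(1 + real (delay N p)) * max 1 (ln (max_rcvd N X p / f0))
              \<le> \<epsilon>\<^sup>2 * \<beta> * v * card (active N p)"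
  shows "(1 - 9 * \<epsilon>) * (\<epsilon> * v * card (active N p)) \<le> congestion_price p"
proof -
  define n where "n = real (card (active N p))"
  define m where "m = 1 + real (delay N p)"
  define L where "L = max 1 (ln (max_rcvd N X p / f0))"
  define \<Lambda> where "\<Lambda> = (\<Sum>t\<in>receiving N p. lsr N X p t)"
  have "\<epsilon> * v \<le> 1/2 * 1" using \<epsilon> v by (intro mult_mono) auto
  then have \<alpha>_le: "\<alpha> \<le> \<beta> / 2" using \<beta> unfolding \<alpha>_eq by (simp add: algebra_simps)
  have L: "m * L \<le> \<epsilon>\<^sup>2 * \<beta> * v * n" "1 \<le> L" and n: "0 \<le> n" and m: "0 < m"
    using T unfolding m_def L_def n_def by auto
  have mL: "m * 1 \<le> m * L" using L m by (intro mult_left_mono) auto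
  have "\<epsilon>\<^sup>2 * \<beta> * v * n \<le> \<epsilon> * n"
  proof -
    have "\<epsilon> * \<beta> * v \<le> 1 * 1 * 1" using \<epsilon> \<beta> v by (intro mult_mono) auto
    then have "(\<epsilon> * n) * (\<epsilon> * \<beta> * v) \<le> (\<epsilon> * n) * 1"
      using \<epsilon> n by (intro mult_left_mono) auto
    then show ?thesis by (simp add: power2_eq_square algebra_simps)
  qed
  with mL L have m_le: "m \<le> \<epsilon> * n" by linarith
  have "\<alpha> * (1 - 2 * \<alpha>) * (n - m) - m * ln (max f0 (2 * max_rcvd N X p) / f0)
      \<le> \<beta> * (1 + 2 * \<beta>) * \<Lambda>"
    using S.sum_loss_rate_ge[OF _ _ sent_le_max_rcvd] \<alpha>_le \<beta> \<beta>_le \<epsilon>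
    unfolding n_def m_def \<Lambda>_def sum_receiving by simp
  moreover have "m * ln (max f0 (2 * max_rcvd N X p) / f0) \<le> m * (2 * L)"
    using ln_max_sent_le m unfolding L_def by (intro mult_left_mono) auto
  \<comment> \<open>The quadratic error costs \<open>2 * \<epsilon>\<close> and the initial window
    another \<open>\<epsilon>\<close>; the logarithmic term \<open>2 * m * L\<close> below costs
    \<open>2 * \<epsilon>\<close> more, together the 5 in \<open>1 - 5 * \<epsilon>\<close>.\<close>
  moreover have "\<alpha> * ((1 - 2 * \<epsilon>) * ((1 - \<epsilon>) * n)) \<le> \<alpha> * ((1 - 2 * \<alpha>) * (n - m))"
    using \<alpha> \<alpha>_le \<beta> \<beta>_le \<epsilon> n m_le mult_right_mono[of \<epsilon> 1 n]
    by (intro mult_left_mono mult_mono) (auto simp: algebra_simps)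
  moreover have "\<beta> * (1 + 2 * \<beta>) * \<Lambda> \<le> \<beta> * (1 + 2 * \<epsilon>) * \<Lambda>"
    using \<beta> \<beta>_le S.l_nonneg unfolding \<Lambda>_def sum_receiving
    by (intro mult_right_mono mult_left_mono sum_nonneg) auto
  ultimately have "\<alpha> * ((1 - 2 * \<epsilon>) * ((1 - \<epsilon>) * n)) - 2 * (\<epsilon>\<^sup>2 * \<beta> * v * n) \<le> \<beta> * (1 + 2 * \<epsilon>) * \<Lambda>"
    using L by (simp add: mult.assoc)
  then have "\<beta> * (\<epsilon> * v * n * ((1 - 2 * \<epsilon>) * (1 - \<epsilon>) - 2 * \<epsilon>)) \<le> \<beta> * ((1 + 2 * \<epsilon>) * \<Lambda>)"
    unfolding \<alpha>_eq by (simp add: power2_eq_square algebra_simps)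
  then have "\<epsilon> * v * n * ((1 - 2 * \<epsilon>) * (1 - \<epsilon>) - 2 * \<epsilon>) \<le> (1 + 2 * \<epsilon>) * \<Lambda>"
    using \<beta> by simp
  moreover have "\<epsilon> * v * n * (1 - 5 * \<epsilon>) \<le> \<epsilon> * v * n * ((1 - 2 * \<epsilon>) * (1 - \<epsilon>) - 2 * \<epsilon>)"
    using \<epsilon> v n by (intro mult_left_mono) (auto simp: algebra_simps)
  moreover have "(1 + 2 * \<epsilon>) * \<Lambda> \<le> (1 + 2 * \<epsilon>) * ((1 + \<epsilon>) * congestion_price p)"
    using fair \<epsilon> unfolding fair_loss_def congestion_price_def \<Lambda>_def
    by (intro mult_left_mono) auto
  \<comment> \<open>This uses \<open>\<epsilon> \<le> 1/2\<close>. Dividing by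
    \<open>1 + 4 * \<epsilon>\<close> turns the loss of \<open>5 * \<epsilon>\<close> into
    \<open>9 * \<epsilon>\<close>.\<close>
  moreover have "(1 + 2 * \<epsilon>) * (1 + \<epsilon>) * congestion_price p \<le> (1 + 4 * \<epsilon>) * congestion_price p"
    using \<epsilon> congestion_price_nonneg by (intro mult_right_mono) (auto simp: algebra_simps)
  moreover have "\<epsilon> * v * n * ((1 - 9 * \<epsilon>) * (1 + 4 * \<epsilon>)) \<le> \<epsilon> * v * n * (1 - 5 * \<epsilon>)"
    using \<epsilon> v n by (intro mult_left_mono) (auto simp: algebra_simps)
  ultimately have "(1 + 4 * \<epsilon>) * ((1 - 9 * \<epsilon>) * (\<epsilon> * v * n)) \<le> (1 + 4 * \<epsilon>) * congestion_price p"
    by (simp add: algebra_simps)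
  then show ?thesis using \<epsilon> unfolding n_def by simp
qed

end

section \<open>Comparing the throughput with the optimum\<close>

lemma throughput_nonneg: "\<forall>p\<in>paths N. 0 \<le> val N p \<Longrightarrow> 0 \<le> throughput N X"
  unfolding throughput_def by (intro sum_nonneg mult_nonneg_nonneg rcvd_nonneg) auto

text \<open>The total loss lies between about \<open>\<epsilon> * opt N\<close>, by duality, and
  about \<open>\<epsilon> * throughput N X\<close>, by the balance of rates. The 11 is 9 from the
  dual, 1 from the value-weighted losses and 1 from the initial rates.\<close>

lemma throughput_ge:
  fixes \<alpha> \<beta> f0 :: "'p \<Rightarrow> real"
  assumes \<epsilon>: "0 < \<epsilon>" "\<epsilon> < 1"
    and v: "\<forall>p\<in>paths N. 0 < val N p \<and> val N p \<le> 1"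
    and params: "\<forall>p\<in>paths N. 0 < \<beta> p \<and> \<beta> p < 1 \<and> \<beta> p \<le> \<epsilon> \<and> \<alpha> p = \<epsilon> * \<beta> p * val N p"
    and f0: "\<forall>p\<in>paths N. 0 < f0 p" "respects_capacities N f0"
    and protocol: "\<forall>p\<in>paths N. linear_MIMD N X p (\<alpha> p) (\<beta> p) (f0 p)"
    and congested: "discards_only_if_congested N X"
    and fair: "\<forall>p\<in>paths N. fair_loss \<epsilon> N X p"
    and T: "\<forall>p\<in>paths N. (1 + real (delay N p)) * max 1 (ln (max_rcvd N X p / f0 p))
              \<le> \<epsilon>\<^sup>2 * \<beta> p * val N p * card (active N p)"
  shows "(1 - 11 * \<epsilon>) * opt N \<le> throughput N X"
proof -
  let ?value = "\<lambda>f. \<Sum>p\<in>paths N. val N p * f p * real (card (active N p))"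
  let ?V = "{?value f | f. respects_capacities N f}"
  define Lost where "Lost = (\<Sum>p\<in>paths N. \<Sum>t\<in>receiving N p. lost N X p t)"
  have opt: "opt N = Sup ?V" unfolding opt_def ..
  have f0_V: "?value f0 \<in> ?V" using f0(2) by blast
  have f0_nonneg: "0 \<le> ?value f0"
    using v f0(1) by (intro sum_nonneg mult_nonneg_nonneg) (auto intro: less_imp_le)
  have f0_le: "?value f0 \<le> opt N"
    using v by (intro value_le_opt f0(2)) (auto intro: less_imp_le)
  have thr: "0 \<le> throughput N X"
    using v by (intro throughput_nonneg) (auto intro: less_imp_le)
  show ?thesis
  \<comment> \<open>For larger \<open>\<epsilon>\<close> the left side is nonpositive; for smaller
    ones \<open>1 - 9 * \<epsilon>\<close> is positive and can be divided by.\<close>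
  proof (cases "\<epsilon> < 1/11")
    case True
    have delay_le: "1 + real (delay N p) \<le> \<epsilon>\<^sup>2 * \<beta> p * val N p * card (active N p)"
      if "p \<in> paths N" for p
    proof -
      have "(1 + real (delay N p)) * 1
          \<le> (1 + real (delay N p)) * max 1 (ln (max_rcvd N X p / f0 p))"
        by (intro mult_left_mono) auto
      also have "\<dots> \<le> \<epsilon>\<^sup>2 * \<beta> p * val N p * card (active N p)" using T that by blast
      finally show ?thesis by simp
    qed
    have long: "1 + delay N p \<le> card (active N p)" if "p \<in> paths N" for p
    proof -
      have "\<epsilon>\<^sup>2 * \<beta> p * val N p \<le> 1 * 1 * 1"
        using \<epsilon> v params that by (intro mult_mono) (auto simp: power_le_one less_imp_le)
      then have "\<epsilon>\<^sup>2 * \<beta> p * val N p * card (active N p) \<le> 1 * real (card (active N p))"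
        by (intro mult_right_mono) auto
      then show ?thesis using delay_le[OF that] by linarith
    qed
    have \<alpha>: "0 \<le> \<alpha> p" if "p \<in> paths N" for p
      using that params v \<epsilon> by (simp add: less_imp_le)
    have dual: "(1 - 9 * \<epsilon>) * \<epsilon> * ?value f \<le> Lost" if f: "respects_capacities N f" for f
    proof -
      have "(1 - 9 * \<epsilon>) * \<epsilon> * ?value f
          = (\<Sum>p\<in>paths N. f p * ((1 - 9 * \<epsilon>) * (\<epsilon> * val N p * card (active N p))))"
        by (simp add: sum_distrib_left algebra_simps)
      also have "\<dots> \<le> (\<Sum>p\<in>paths N. f p * congestion_price p)"
      proof (intro sum_mono mult_left_mono)
        fix p assume p: "p \<in> paths N"
        then show "0 \<le> f p" using f unfolding respects_capacities_def by blast
        show "(1 - 9 * \<epsilon>) * (\<epsilon> * val N p * card (active N p)) \<le> congestion_price p"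
          using congestion_price_ge[of p "\<alpha> p" "\<beta> p" "f0 p" \<epsilon> "val N p"] p protocol params v f0
            long[OF p] \<alpha>[OF p] fair T True \<epsilon> by auto
      qed
      also have "\<dots> \<le> Lost"
        unfolding Lost_def by (rule weak_duality[OF congested f])
      finally show ?thesis .
    qed
    have pos: "0 < (1 - 9 * \<epsilon>) * \<epsilon>" using \<epsilon> True by simp
    have le: "y \<le> Lost / ((1 - 9 * \<epsilon>) * \<epsilon>)" if "y \<in> ?V" for y
      using that dual pos by (auto simp: pos_le_divide_eq mult.commute)
    \<comment> \<open>Bounding a supremum from above needs a nonempty set; \<open>f0\<close> is the
      witness.\<close>
    have opt_le: "opt N \<le> Lost / ((1 - 9 * \<epsilon>) * \<epsilon>)"
      unfolding opt using f0_V le by (intro cSup_least) auto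
    \<comment> \<open>This is \<open>total_lost_le\<close> divided by \<open>\<beta> p\<close>. As
      values are at most 1, the lost part of the sent amount moves to the left at cost
      \<open>\<epsilon>\<close>; the length condition bounds the initial window.\<close>
    have lost_p: "(1 - \<epsilon>) * (\<Sum>t\<in>receiving N p. lost N X p t)
        \<le> \<epsilon> * (\<Sum>t\<in>receiving N p. val N p * rcvd N X p t)
          + \<epsilon>\<^sup>2 * (val N p * f0 p * card (active N p))" if p: "p \<in> paths N" for p
    proof -
      let ?l = "\<Sum>t\<in>receiving N p. lost N X p t" and ?r = "\<Sum>t\<in>receiving N p. rcvd N X p t"
      have b: "0 < \<beta> p" and vp: "0 < val N p" "val N p \<le> 1" and c: "0 < f0 p"
        using params v f0 p by auto
      have l: "0 \<le> ?l" using lost_nonneg[OF p] by (intro sum_nonneg) (auto simp: receiving_def)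
      have "(1 + real (delay N p)) * f0 p \<le> \<epsilon>\<^sup>2 * \<beta> p * val N p * card (active N p) * f0 p"
        using c delay_le[OF p] by (intro mult_right_mono) auto
      moreover have "\<beta> p * ?l \<le> \<alpha> p * (?r + ?l) + (1 + real (delay N p)) * f0 p"
        using total_lost_le[of p "\<alpha> p" "\<beta> p" "f0 p"] p protocol params f0 long[OF p] \<alpha>[OF p]
        by (simp add: sum.distrib)
      ultimately have "\<beta> p * ?l
          \<le> \<beta> p * (\<epsilon> * val N p * (?r + ?l) + \<epsilon>\<^sup>2 * (val N p * f0 p * card (active N p)))"
        using params p by (simp add: algebra_simps)
      then have "?l \<le> \<epsilon> * val N p * (?r + ?l) + \<epsilon>\<^sup>2 * (val N p * f0 p * card (active N p))"
        using b by simp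
      moreover have "\<epsilon> * ?l * val N p \<le> \<epsilon> * ?l * 1"
        using vp \<epsilon> l by (intro mult_left_mono) auto
      ultimately show ?thesis
        by (simp add: sum_distrib_left[symmetric] algebra_simps)
    qed
    have "(1 - \<epsilon>) * Lost = (\<Sum>p\<in>paths N. (1 - \<epsilon>) * (\<Sum>t\<in>receiving N p. lost N X p t))"
      unfolding Lost_def by (simp add: sum_distrib_left)
    also have "\<dots> \<le> (\<Sum>p\<in>paths N. \<epsilon> * (\<Sum>t\<in>receiving N p. val N p * rcvd N X p t)
        + \<epsilon>\<^sup>2 * (val N p * f0 p * card (active N p)))"
      by (intro sum_mono lost_p)
    also have "\<dots> = \<epsilon> * throughput N X + \<epsilon>\<^sup>2 * ?value f0"
      unfolding throughput_def by (simp add: sum.distrib sum_distrib_left)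
    \<comment> \<open>Feasibility of the starting rates makes their error a fraction of the
      optimum.\<close>
    also have "\<dots> \<le> \<epsilon> * throughput N X + \<epsilon>\<^sup>2 * opt N"
      using f0_le by (intro add_left_mono mult_left_mono) auto
    finally have "(1 - \<epsilon>) * Lost \<le> \<epsilon> * throughput N X + \<epsilon>\<^sup>2 * opt N" .
    moreover have "(1 - \<epsilon>) * ((1 - 9 * \<epsilon>) * \<epsilon> * opt N) \<le> (1 - \<epsilon>) * Lost"
      using opt_le pos \<epsilon> by (intro mult_left_mono) (auto simp: pos_le_divide_eq mult.commute)
    ultimately have "\<epsilon> * ((1 - \<epsilon>) * (1 - 9 * \<epsilon>) * opt N) \<le> \<epsilon> * (throughput N X + \<epsilon> * opt N)"
      by (simp add: power2_eq_square algebra_simps)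
    then have "(1 - \<epsilon>) * (1 - 9 * \<epsilon>) * opt N \<le> throughput N X + \<epsilon> * opt N"
      using \<epsilon> by simp
    moreover have "(1 - 10 * \<epsilon>) * opt N \<le> (1 - \<epsilon>) * (1 - 9 * \<epsilon>) * opt N"
      using f0_le f0_nonneg by (intro mult_right_mono) (auto simp: algebra_simps)
    ultimately show ?thesis by (simp add: algebra_simps)
  next
    case False
    have "(1 - 11 * \<epsilon>) * opt N \<le> 0"
      using False f0_nonneg f0_le by (intro mult_nonpos_nonneg) auto
    then show ?thesis using thr by linarith
  qed
qed

end

theorem theorem1:
  shows "\<exists>C1 C2 C3 :: real. C1 > 0 \<and> C2 > 0 \<and> C3 > 0 \<and>
    (\<forall>(\<epsilon>::real) (N :: (nat, nat) network) (X :: (nat, nat) traffic)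
        (\<alpha> :: nat \<Rightarrow> real) (\<beta> :: nat \<Rightarrow> real) (f0 :: nat \<Rightarrow> real).
       0 < \<epsilon> \<and> \<epsilon> < 1 \<and>
       valid_network N \<and> valid_traffic N X \<and>
       (\<forall>p\<in>paths N. 0 < val N p \<and> val N p \<le> 1) \<and>
       (\<forall>p\<in>paths N. 0 < \<beta> p \<and> \<beta> p < 1 \<and> \<beta> p \<le> C1 * \<epsilon> \<and> \<alpha> p = \<epsilon> * \<beta> p * val N p) \<and>
       (\<forall>p\<in>paths N. 0 < f0 p) \<and> respects_capacities N f0 \<and>
       (\<forall>p\<in>paths N. linear_MIMD N X p (\<alpha> p) (\<beta> p) (f0 p)) \<and>
       discards_only_if_congested N X \<and>
       (\<forall>p\<in>paths N. fair_loss \<epsilon> N X p) \<and>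
       (\<forall>p\<in>paths N. real (card (active N p)) \<ge>
          C2 * Max ((\<lambda>q. (1 + real (delay N q)) * max 1 (ln (max_rcvd N X q / f0 q))
                           / (\<epsilon>\<^sup>2 * \<beta> q * val N q)) ` paths N))
       \<longrightarrow> throughput N X \<ge> (1 - C3 * \<epsilon>) * opt N)"
proof -
  \<comment> \<open>The constants are \<open>C1 = C2 = 1\<close> and \<open>C3 = 11\<close>; the
    factors \<open>1 *\<close> keep the shape of the existential statement.\<close>
  have "(1 - 11 * \<epsilon>) * opt N \<le> throughput N X"
    if "0 < \<epsilon>" "\<epsilon> < 1" and N: "valid_network N" and X: "valid_traffic N X"
      and v: "\<forall>p\<in>paths N. 0 < val N p \<and> val N p \<le> 1"
      and params: "\<forall>p\<in>paths N. 0 < \<beta> p \<and> \<beta> p < 1 \<and> \<beta> p \<le> 1 * \<epsilon> \<and> \<alpha> p = \<epsilon> * \<beta> p * val N p"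
      and "\<forall>p\<in>paths N. 0 < f0 p" "respects_capacities N f0"
      and "\<forall>p\<in>paths N. linear_MIMD N X p (\<alpha> p) (\<beta> p) (f0 p)"
      and "discards_only_if_congested N X" and "\<forall>p\<in>paths N. fair_loss \<epsilon> N X p"
      and T: "\<forall>p\<in>paths N. real (card (active N p)) \<ge>
          1 * Max ((\<lambda>q. (1 + real (delay N q)) * max 1 (ln (max_rcvd N X q / f0 q))
                           / (\<epsilon>\<^sup>2 * \<beta> q * val N q)) ` paths N)"
    for \<epsilon> and N :: "(nat, nat) network" and X :: "(nat, nat) traffic"
      and \<alpha> \<beta> f0 :: "nat \<Rightarrow> real"
  proof (rule throughput_ge[OF N X])
    show "\<forall>p\<in>paths N. (1 + real (delay N p)) * max 1 (ln (max_rcvd N X p / f0 p))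
              \<le> \<epsilon>\<^sup>2 * \<beta> p * val N p * card (active N p)"
    proof
      fix p assume p: "p \<in> paths N"
      let ?g = "\<lambda>q. (1 + real (delay N q)) * max 1 (ln (max_rcvd N X q / f0 q))
                           / (\<epsilon>\<^sup>2 * \<beta> q * val N q)"
      have "?g p \<le> Max (?g ` paths N)"
        using finite_paths[OF N X] p by (intro Max_ge) auto
      also have "\<dots> \<le> real (card (active N p))" using T p by simp
      finally have le: "?g p \<le> real (card (active N p))" .
      have "0 < \<epsilon>\<^sup>2 * \<beta> p * val N p" using that(1) params v p by simp
      with le show "(1 + real (delay N p)) * max 1 (ln (max_rcvd N X p / f0 p))
              \<le> \<epsilon>\<^sup>2 * \<beta> p * val N p * card (active N p)"
        by (simp only: pos_divide_le_eq mult.commute)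
    qed
  qed (use that in auto)
  then show ?thesis
    by (intro exI[of _ 1] exI[of _ "1::real"] exI[of _ 11]) auto
qed

end
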